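(* Let $\bm{M},\bm{D},\bm{K}\in\mathbb{R}^{n\times n}$, $\bm{B}\in\mathbb{R}^{n\times p_i}$, $\bm{C}\in\mathbb{R}^{p_o\times n}$, and let $s_0=ik_0$ with $k_0>0$ be an expansion point such that $\tilde{\bm{K}}=s_0^2\bm{M}+s_0\bm{D}+\bm{K}$ is invertible. Let $s\in\mathbb{C}$ be sufficiently close to $s_0$ that the full order transfer function $\bm{G}(s)$ is well-defined (the inverse in its definition exists). Let $r\ge 1$, and let $\bm{G}_r$ and $\bm{G}_{r+1}$ be the transfer functions of the reduced order models obtained after $r$ and $r+1$ iterations, respectively, of a second order Krylov subspace-based model order reduction method about $s_0$ (as defined in the context). Suppose that $\bm{G}_r(s)$ and $\bm{G}_{r+1}(s)$ are well-defined (the inverses in their definitions exist) for $s$ sufficiently close to $s_0$, including $s=s_0$. Let $\|\cdot\|$ be a norm on $\mathbb{C}^{p_o\times p_i}$. Then $\|\bm{G}_{r+1}(s)-\bm{G}_r(s)\|$ is an estimator for the absolute error $\|\bm{G}(s)-\bm{G}_r(s)\|$ in the sense that $$\|\bm{G}(s)-\bm{G}_r(s)\| = \|\bm{G}_{r+1}(s)-\bm{G}_r(s)\| + \mathcal{O}\big((s-s_0)^{r+1}\big)\qquad\text{as } s\to s_0.$$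
   Context: Full order model. Given $\bm{M},\bm{D},\bm{K}\in\mathbb{R}^{n\times n}$, $\bm{B}\in\mathbb{R}^{n\times p_i}$, $\bm{C}\in\mathbb{R}^{p_o\times n}$ and $s_0=ik_0$, set $\tilde{\bm{K}}=s_0^2\bm{M}+s_0\bm{D}+\bm{K}$ and $\tilde{\bm{D}}=2s_0\bm{M}+\bm{D}$. The transfer function is $$\bm{G}(s)=\bm{C}\,[(s-s_0)^2\bm{M}+(s-s_0)\tilde{\bm{D}}+\tilde{\bm{K}}]^{-1}\bm{B}.$$ Second order Krylov subspaces. For $\bm{A}_1,\bm{A}_2\in\mathbb{C}^{n\times n}$ and $\bm{P}_0\in\mathbb{C}^{n\times m}$, put $\bm{P}_1=\bm{A}_1\bm{P}_0$ and $\bm{P}_j=\bm{A}_1\bm{P}_{j-1}+\bm{A}_2\bm{P}_{j-2}$ for $j\ge2$, and let $\mathcal{K}_r(\bm{A}_1,\bm{A}_2,\bm{P}_0)\subset\mathbb{C}^n$ be the span of all columns of $\bm{P}_0,\dots,\bm{P}_{r-1}$. The input Krylov subspace about $s_0$ is $\mathcal{K}_r(-\tilde{\bm{K}}^{-1}\tilde{\bm{D}},-\tilde{\bm{K}}^{-1}\bm{M},-\tilde{\bm{K}}^{-1}\bm{B})$, and the output Krylov subspace is $\mathcal{K}_r(-\tilde{\bm{K}}^{-T}\tilde{\bm{D}}^T,-\tilde{\bm{K}}^{-T}\bm{M}^T,-\tilde{\bm{K}}^{-T}\bm{C}^T)$. Reduced order model. After $r$ iterations, a Krylov subspace-based method uses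 matrices $\bm{V},\bm{W}$ with the same number of columns, where either (one-sided) $\bm{W}=\bm{V}$ and the columns of $\bm{V}$ form an orthonormal basis of the input Krylov subspace (or of the output Krylov subspace), or (two-sided) the columns of $\bm{V}$ form an orthonormal basis of the input Krylov subspace and those of $\bm{W}$ an orthonormal basis of the output Krylov subspace, all built with index $r$. The same type of method is used for $r$ and $r+1$. For a single input and single output, generically $\bm{V}$ has $r$ columns, so the model has order $r$. Set $\{\bm{M}_r,\bm{D}_r,\bm{K}_r\}=\bm{W}^T\{\bm{M},\bm{D},\bm{K}\}\bm{V}$, $\bm{B}_r=\bm{W}^T\bm{B}$, $\bm{C}_r=\bm{C}\bm{V}$, $\tilde{\bm{K}}_r=s_0^2\bm{M}_r+s_0\bm{D}_r+\bm{K}_r$, $\tilde{\bm{D}}_r=2s_0\bm{M}_r+\bm{D}_r$. The reduced transfer function is $$\bm{G}_r(s)=\bm{C}_r\,[(s-s_0)^2\bm{M}_r+(s-s_0)\tilde{\bm{D}}_r+\tilde{\bm{K}}_r]^{-1}\bm{B}_r.$$ Here $f(s)=g(s)+\mathcal{O}((s-s_0)^{r+1})$ means that there are constants $c,\delta>0$ (possibly depending on $r$ and the system) with $|f(s)-g(s)|\le c|s-s_0|^{r+1}$ for $|s-s_0|<\delta$. *)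

theory Defs
  imports
    "HOL-Library.Landau_Symbols"
    "Jordan_Normal_Form.Gauss_Jordan_Elimination"
    "Jordan_Normal_Form.VS_Connect"
begin

(* Matrices carry their dimensions as natural numbers, because the number of columns of a
   projection matrix is not fixed in advance and may even be 0 (e.g. for a zero input matrix). *)

(* Meaningful only for invertible_mat A; otherwise the value is unspecified. *)
definition minv :: "complex mat \<Rightarrow> complex mat" where
  "minv A = the (mat_inverse A)"

abbreviation complex_mat :: "real mat \<Rightarrow> complex mat" where
  "complex_mat \<equiv> map_mat complex_of_real"

record so_model =
  mass_mat :: "complex mat"
  damping_mat :: "complex mat"
  stiffness_mat :: "complex mat"
  input_mat :: "complex mat"
  output_mat :: "complex mat"

definition full_model ::
  "real mat \<Rightarrow> real mat \<Rightarrow> real mat \<Rightarrow> real mat \<Rightarrow> real mat \<Rightarrow> so_model" where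
  "full_model M D K B C =
     \<lparr>mass_mat = complex_mat M, damping_mat = complex_mat D, stiffness_mat = complex_mat K,
      input_mat = complex_mat B, output_mat = complex_mat C\<rparr>"

definition shifted_stiffness :: "complex \<Rightarrow> so_model \<Rightarrow> complex mat" where
  "shifted_stiffness s\<^sub>0 S = s\<^sub>0\<^sup>2 \<cdot>\<^sub>m mass_mat S + s\<^sub>0 \<cdot>\<^sub>m damping_mat S + stiffness_mat S"

definition shifted_damping :: "complex \<Rightarrow> so_model \<Rightarrow> complex mat" where
  "shifted_damping s\<^sub>0 S = (2 * s\<^sub>0) \<cdot>\<^sub>m mass_mat S + damping_mat S"

definition dynamic_mat :: "complex \<Rightarrow> so_model \<Rightarrow> complex \<Rightarrow> complex mat" where
  "dynamic_mat s\<^sub>0 S s =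
     (s - s\<^sub>0)\<^sup>2 \<cdot>\<^sub>m mass_mat S + (s - s\<^sub>0) \<cdot>\<^sub>m shifted_damping s\<^sub>0 S + shifted_stiffness s\<^sub>0 S"

definition transfer :: "complex \<Rightarrow> so_model \<Rightarrow> complex \<Rightarrow> complex mat" where
  "transfer s\<^sub>0 S s = output_mat S * minv (dynamic_mat s\<^sub>0 S s) * input_mat S"

definition transfer_defined :: "complex \<Rightarrow> so_model \<Rightarrow> complex \<Rightarrow> bool" where
  "transfer_defined s\<^sub>0 S s \<longleftrightarrow> invertible_mat (dynamic_mat s\<^sub>0 S s)"

abbreviation cspan :: "nat \<Rightarrow> complex vec set \<Rightarrow> complex vec set" where
  "cspan n \<equiv> LinearCombinations.module.span class_ring (module_vec TYPE(complex) n)"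

fun krylov_block :: "complex mat \<Rightarrow> complex mat \<Rightarrow> complex mat \<Rightarrow> nat \<Rightarrow> complex mat" where
  "krylov_block A\<^sub>1 A\<^sub>2 P 0 = P"
| "krylov_block A\<^sub>1 A\<^sub>2 P (Suc 0) = A\<^sub>1 * P"
| "krylov_block A\<^sub>1 A\<^sub>2 P (Suc (Suc j)) =
     A\<^sub>1 * krylov_block A\<^sub>1 A\<^sub>2 P (Suc j) + A\<^sub>2 * krylov_block A\<^sub>1 A\<^sub>2 P j"

definition krylov_space ::
  "nat \<Rightarrow> complex mat \<Rightarrow> complex mat \<Rightarrow> complex mat \<Rightarrow> complex vec set" where
  "krylov_space r A\<^sub>1 A\<^sub>2 P = cspan (dim_row P) (\<Union>j<r. set (cols (krylov_block A\<^sub>1 A\<^sub>2 P j)))"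

definition input_krylov :: "complex \<Rightarrow> so_model \<Rightarrow> nat \<Rightarrow> complex vec set" where
  "input_krylov s\<^sub>0 S r =
     (let Ki = minv (shifted_stiffness s\<^sub>0 S)
      in krylov_space r (- Ki * shifted_damping s\<^sub>0 S) (- Ki * mass_mat S) (- Ki * input_mat S))"

definition output_krylov :: "complex \<Rightarrow> so_model \<Rightarrow> nat \<Rightarrow> complex vec set" where
  "output_krylov s\<^sub>0 S r =
     (let KiT = transpose_mat (minv (shifted_stiffness s\<^sub>0 S))
      in krylov_space r
           (- KiT * transpose_mat (shifted_damping s\<^sub>0 S))
           (- KiT * transpose_mat (mass_mat S))
           (- KiT * transpose_mat (output_mat S)))"

(* Orthonormality is with respect to the Hermitian inner product; it makes the columns
   distinct and linearly independent, so together with the spanning condition they form a basis. *)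
definition orthonormal_basis_mat :: "nat \<Rightarrow> complex mat \<Rightarrow> complex vec set \<Rightarrow> bool" where
  "orthonormal_basis_mat n V U \<longleftrightarrow>
     dim_row V = n \<and>
     (\<forall>i<dim_col V. \<forall>j<dim_col V. col V i \<bullet>c col V j = (if i = j then 1 else 0)) \<and>
     cspan n (set (cols V)) = U"

datatype krylov_method = One_Sided_Input | One_Sided_Output | Two_Sided

fun krylov_projection ::
  "krylov_method \<Rightarrow> complex \<Rightarrow> so_model \<Rightarrow> nat \<Rightarrow> complex mat \<Rightarrow> complex mat \<Rightarrow> bool" where
  "krylov_projection One_Sided_Input s\<^sub>0 S r V W \<longleftrightarrow>
     W = V \<and> orthonormal_basis_mat (dim_row (mass_mat S)) V (input_krylov s\<^sub>0 S r)"
| "krylov_projection One_Sided_Output s\<^sub>0 S r V W \<longleftrightarrow>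
     W = V \<and> orthonormal_basis_mat (dim_row (mass_mat S)) V (output_krylov s\<^sub>0 S r)"
| "krylov_projection Two_Sided s\<^sub>0 S r V W \<longleftrightarrow>
     dim_col V = dim_col W \<and>
     orthonormal_basis_mat (dim_row (mass_mat S)) V (input_krylov s\<^sub>0 S r) \<and>
     orthonormal_basis_mat (dim_row (mass_mat S)) W (output_krylov s\<^sub>0 S r)"

(* The projection uses the plain transpose of W, without conjugation. *)
definition reduced_model :: "complex mat \<Rightarrow> complex mat \<Rightarrow> so_model \<Rightarrow> so_model" where
  "reduced_model V W S =
     \<lparr>mass_mat = transpose_mat W * mass_mat S * V,
      damping_mat = transpose_mat W * damping_mat S * V,
      stiffness_mat = transpose_mat W * stiffness_mat S * V,
      input_mat = transpose_mat W * input_mat S,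
      output_mat = output_mat S * V\<rparr>"

definition matrix_norm_on :: "nat \<Rightarrow> nat \<Rightarrow> (complex mat \<Rightarrow> real) \<Rightarrow> bool" where
  "matrix_norm_on m k N \<longleftrightarrow>
     (\<forall>A \<in> carrier_mat m k. 0 \<le> N A \<and> (N A = 0 \<longleftrightarrow> A = 0\<^sub>m m k)) \<and>
     (\<forall>a. \<forall>A \<in> carrier_mat m k. N (a \<cdot>\<^sub>m A) = cmod a * N A) \<and>
     (\<forall>A \<in> carrier_mat m k. \<forall>B \<in> carrier_mat m k. N (A + B) \<le> N A + N B)"

end

theory Submission
  imports Defs
begin

text \<open>
  By the reverse triangle inequality the claim reduces to
  \<open>G(s) - G\<^bsub>r+1\<^esub>(s) = O((s - s\<^sub>0) ^ (r + 1))\<close>. The matrix polynomial with the first \<open>r + 1\<close> Krylov blocks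
  as coefficients has its columns in the span of \<open>V\<close> and solves the full order system up to a
  residual \<open>(s - s\<^sub>0) ^ (r + 1) \<cdot>\<^sub>m E s\<close>. Galerkin projection reproduces it up to the projected residual,
  so the difference of the transfer functions is \<open>(s - s\<^sub>0) ^ (r + 1)\<close> times an expression built from
  \<open>E s\<close> and the two inverses, all of which are continuous at \<open>s\<^sub>0\<close>. If only the output Krylov space
  is available, the same argument is applied to the transposed system.
\<close>

section \<open>Inverses and continuity of matrix-valued functions\<close>

lemma inverse_mat_unique:
  fixes A :: "'a :: comm_ring_1 mat"
  assumes "A \<in> carrier_mat n n" "X \<in> carrier_mat n n" "Y \<in> carrier_mat n n"
    and "X * A = 1\<^sub>m n" "A * Y = 1\<^sub>m n"
  shows "X = Y"
proof -
  have "X = X * (A * Y)" using assms by simp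
  also have "\<dots> = (X * A) * Y" using assms(1-3) by simp
  finally show ?thesis using assms by simp
qed

lemma invertible_matE:
  fixes A :: "'a :: comm_ring_1 mat"
  assumes "invertible_mat A" "A \<in> carrier_mat n n"
  obtains X where "X \<in> carrier_mat n n" "A * X = 1\<^sub>m n" "X * A = 1\<^sub>m n"
proof -
  obtain X where X: "A * X = 1\<^sub>m n" "X * A = 1\<^sub>m (dim_row X)"
    using assms unfolding invertible_mat_def inverts_mat_def by auto
  \<comment> \<open>The definition of invertibility leaves the dimensions of \<open>X\<close> open;
    counting columns in the two identities fixes both.\<close>
  have "dim_col X = n" using arg_cong[OF X(1), of dim_col] by simp
  moreover have "dim_row X = n" using arg_cong[OF X(2), of dim_col] assms(2) by simp
  ultimately show thesis using X that[of X] by auto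
qed

text \<open>\<open>mat_inverse\<close> is specified through the units of the ring of square
  matrices, so the two-sided inverse is first recast as a unit; this rules out \<open>None\<close>,
  where \<open>minv\<close> would be unspecified.\<close>

lemma minv:
  assumes "invertible_mat A" "A \<in> carrier_mat n n"
  shows "minv A \<in> carrier_mat n n" "A * minv A = 1\<^sub>m n" "minv A * A = 1\<^sub>m n"
proof -
  obtain X where "X \<in> carrier_mat n n" "A * X = 1\<^sub>m n" "X * A = 1\<^sub>m n"
    using invertible_matE[OF assms] .
  then have "A \<in> Units (ring_mat TYPE(complex) n ())"
    using assms(2) unfolding Units_def by (auto simp: ring_mat_simps)
  then obtain Z where "mat_inverse A = Some Z"
    using mat_inverse(1)[OF assms(2), where b = "()"] by (cases "mat_inverse A") auto
  then show "minv A \<in> carrier_mat n n" "A * minv A = 1\<^sub>m n" "minv A * A = 1\<^sub>m n"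
    using mat_inverse(2)[OF assms(2)] unfolding minv_def by auto
qed

lemma minv_eqI:
  assumes "A \<in> carrier_mat n n" "X \<in> carrier_mat n n" "A * X = 1\<^sub>m n" "X * A = 1\<^sub>m n"
  shows "invertible_mat A" "minv A = X"
proof -
  show inv: "invertible_mat A"
    using assms unfolding invertible_mat_def inverts_mat_def square_mat.simps by auto
  show "minv A = X"
    using inverse_mat_unique[OF assms(1) minv(1)[OF inv assms(1)] assms(2) minv(3)[OF inv assms(1)] assms(3)] .
qed

text \<open>The adjugate formula writes the inverse as a rational expression in the entries, which
  is where its continuity comes from.\<close>

lemma minv_adj_mat:
  assumes "A \<in> carrier_mat n n" "det A \<noteq> 0"
  shows "invertible_mat A" "minv A = inverse (det A) \<cdot>\<^sub>m adj_mat A"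
proof -
  have *: "A * (inverse (det A) \<cdot>\<^sub>m adj_mat A) = 1\<^sub>m n" "(inverse (det A) \<cdot>\<^sub>m adj_mat A) * A = 1\<^sub>m n"
    using adj_mat[OF assms(1)] assms
    by (auto simp: mult_smult_distrib[OF assms(1)] mult_smult_assoc_mat[OF _ assms(1)] intro!: eq_matI)
  show "invertible_mat A" "minv A = inverse (det A) \<cdot>\<^sub>m adj_mat A"
    using minv_eqI[OF assms(1) _ *] adj_mat(1)[OF assms(1)] by auto
qed

lemma invertible_mat_det:
  assumes "invertible_mat A" "A \<in> carrier_mat n n"
  shows "det A \<noteq> (0 :: complex)"
  using invertible_matE[OF assms] det_mult[OF assms(2)]
  by (metis det_one mult_zero_left zero_neq_one)

text \<open>The type of matrices mixes all sizes, so continuity is taken entry by entry. The size is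
  prescribed at every \<open>s\<close>, not just near \<open>a\<close>, so that sums and products
  have a fixed shape everywhere.\<close>

definition mat_cont_at :: "complex \<Rightarrow> nat \<Rightarrow> nat \<Rightarrow> (complex \<Rightarrow> complex mat) \<Rightarrow> bool" where
  "mat_cont_at a nr nc F \<longleftrightarrow>
     (\<forall>s. F s \<in> carrier_mat nr nc) \<and> (\<forall>i<nr. \<forall>j<nc. isCont (\<lambda>s. F s $$ (i, j)) a)"

section \<open>Closure properties of entrywise continuity\<close>

lemma mat_cont_at_carrier: "mat_cont_at a nr nc F \<Longrightarrow> F s \<in> carrier_mat nr nc"
  by (simp add: mat_cont_at_def)

lemma mat_cont_at_const: "A \<in> carrier_mat nr nc \<Longrightarrow> mat_cont_at a nr nc (\<lambda>_. A)"
  by (simp add: mat_cont_at_def)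

lemma mat_cont_at_add:
  assumes "mat_cont_at a nr nc F" "mat_cont_at a nr nc G"
  shows "mat_cont_at a nr nc (\<lambda>s. F s + G s)"
proof -
  have [simp]: "F s \<in> carrier_mat nr nc" "G s \<in> carrier_mat nr nc"
    "dim_row (G s) = nr" "dim_col (G s) = nc" for s
    using assms by (auto simp: mat_cont_at_def)
  show ?thesis using assms by (auto simp: mat_cont_at_def)
qed

lemma mat_cont_at_diff:
  assumes "mat_cont_at a nr nc F" "mat_cont_at a nr nc G"
  shows "mat_cont_at a nr nc (\<lambda>s. F s - G s)"
proof -
  have [simp]: "F s \<in> carrier_mat nr nc" "G s \<in> carrier_mat nr nc"
    "dim_row (G s) = nr" "dim_col (G s) = nc" for s
    using assms by (auto simp: mat_cont_at_def)
  show ?thesis using assms by (auto simp: mat_cont_at_def)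
qed

lemma mat_cont_at_smult:
  assumes "isCont f a" "mat_cont_at a nr nc F"
  shows "mat_cont_at a nr nc (\<lambda>s. f s \<cdot>\<^sub>m F s)"
proof -
  have [simp]: "F s \<in> carrier_mat nr nc" "dim_row (F s) = nr" "dim_col (F s) = nc" for s
    using assms by (auto simp: mat_cont_at_def)
  show ?thesis using assms by (auto simp: mat_cont_at_def)
qed

lemma mat_cont_at_mult:
  assumes "mat_cont_at a nr n F" "mat_cont_at a n nc G"
  shows "mat_cont_at a nr nc (\<lambda>s. F s * G s)"
proof -
  have [simp]: "F s \<in> carrier_mat nr n" "G s \<in> carrier_mat n nc"
    "dim_row (F s) = nr" "dim_col (F s) = n" "dim_row (G s) = n" "dim_col (G s) = nc" for s
    using assms by (auto simp: mat_cont_at_def)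
  have "isCont (\<lambda>s. \<Sum>k<n. F s $$ (i, k) * G s $$ (k, j)) a" if "i < nr" "j < nc" for i j
    using assms that by (intro continuous_intros) (auto simp: mat_cont_at_def)
  then show ?thesis
    using mult_carrier_mat[of "F _" nr n "G _" nc]
    by (simp add: mat_cont_at_def scalar_prod_def lessThan_atLeast0)
qed

text \<open>By the Leibniz formula the determinant is a polynomial in the entries.\<close>

lemma isCont_det:
  assumes "mat_cont_at a n n F"
  shows "isCont (\<lambda>s. det (F s)) a"
proof -
  have "isCont (\<lambda>s. \<Sum>p\<in>{p. p permutes {0..<n}}. signof p * (\<Prod>i = 0..<n. F s $$ (i, p i))) a"
  proof (intro continuous_intros)
    fix p i assume "p \<in> {p. p permutes {0..<n}}" "i \<in> {0..<n}"
    then have "i < n" "p i < n" using permutes_in_image[of p "{0..<n}" i] by auto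
    then show "isCont (\<lambda>s. F s $$ (i, p i)) a" using assms by (simp add: mat_cont_at_def)
  qed
  moreover have "det (F s) = (\<Sum>p\<in>{p. p permutes {0..<n}}. signof p * (\<Prod>i = 0..<n. F s $$ (i, p i)))" for s
    using assms by (intro det_def') (simp add: mat_cont_at_def)
  ultimately show ?thesis by simp
qed

text \<open>Each entry of the adjugate is, up to sign, the determinant of a minor, and the entries
  of a minor are entries of \<open>F\<close>.\<close>

lemma mat_cont_at_adj_mat:
  assumes "mat_cont_at a n n F"
  shows "mat_cont_at a n n (\<lambda>s. adj_mat (F s))"
proof -
  have [simp]: "F s \<in> carrier_mat n n" "dim_row (F s) = n" "dim_col (F s) = n" for s
    using assms by (auto simp: mat_cont_at_def)
  have "mat_cont_at a (n - 1) (n - 1) (\<lambda>s. mat_delete (F s) j i)" if "i < n" "j < n" for i j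
    using assms that by (auto simp: mat_cont_at_def mat_delete_def)
  then have "isCont (\<lambda>s. cofactor (F s) j i) a" if "i < n" "j < n" for i j
    unfolding cofactor_def using that by (intro continuous_intros isCont_det)
  then show ?thesis
    using adj_mat(1)[of "F _" n] by (simp add: mat_cont_at_def adj_mat_def)
qed

text \<open>\<open>minv\<close> has no specified dimensions on singular matrices, so the inverse function is replaced
  by an everywhere defined one that agrees with it near \<open>a\<close>.\<close>

lemma mat_cont_at_minv:
  assumes "mat_cont_at a n n F" "invertible_mat (F a)"
  obtains Z where "mat_cont_at a n n Z"
    "\<forall>\<^sub>F s in nhds a. invertible_mat (F s) \<and> minv (F s) = Z s"
proof
  let ?Z = "\<lambda>s. inverse (det (F s)) \<cdot>\<^sub>m adj_mat (F s)"
  have F: "F s \<in> carrier_mat n n" for s using assms by (simp add: mat_cont_at_def)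
  have det: "isCont (\<lambda>s. det (F s)) a" using isCont_det[OF assms(1)] .
  have nz: "det (F a) \<noteq> 0" using invertible_mat_det[OF assms(2) F] .
  show "mat_cont_at a n n ?Z"
    by (intro mat_cont_at_smult mat_cont_at_adj_mat assms continuous_intros det nz)
  \<comment> \<open>\<open>isCont\<close> concerns the punctured filter \<open>at a\<close>; passing
    to \<open>nhds a\<close> keeps the point \<open>a\<close> itself in the conclusion.\<close>
  have "((\<lambda>s. det (F s)) \<longlongrightarrow> det (F a)) (nhds a)"
    using det tendsto_at_iff_tendsto_nhds[of "\<lambda>s. det (F s)" a] by (simp add: isCont_def)
  then have "\<forall>\<^sub>F s in nhds a. det (F s) \<noteq> 0"
    using nz by (rule tendsto_imp_eventually_ne)
  then show "\<forall>\<^sub>F s in nhds a. invertible_mat (F s) \<and> minv (F s) = ?Z s"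
    by eventually_elim (use minv_adj_mat[OF F] in auto)
qed

section \<open>Norms on matrices\<close>

lemma matrix_norm_onD:
  assumes "matrix_norm_on nr nc N" "A \<in> carrier_mat nr nc" "B \<in> carrier_mat nr nc"
  shows "0 \<le> N A" "N (0\<^sub>m nr nc) = 0" "N (a \<cdot>\<^sub>m A) = cmod a * N A" "N (A + B) \<le> N A + N B"
  using assms zero_carrier_mat[of nr nc] unfolding matrix_norm_on_def by blast+

text \<open>Expanding \<open>A\<close> in matrix units and applying the triangle inequality bounds
  an arbitrary norm by the moduli of the entries with fixed weights. This is the half of norm
  equivalence needed to pass from entries to norms.\<close>

lemma matrix_norm_on_le_sum:
  assumes N: "matrix_norm_on nr nc N" and A: "A \<in> carrier_mat nr nc"
  shows "N A \<le> (\<Sum>(i, j)\<in>{..<nr} \<times> {..<nc}.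
           cmod (A $$ (i, j)) * N (mat nr nc (\<lambda>p. if p = (i, j) then 1 else 0)))"
proof -
  let ?E = "\<lambda>q. mat nr nc (\<lambda>p. if p = q then 1 else 0 :: complex)"
  \<comment> \<open>\<open>?R T\<close> keeps the entries of \<open>A\<close> at positions in
    \<open>T\<close> and is zero elsewhere, so the induction on \<open>T\<close> adds one matrix
    unit at a time.\<close>
  let ?R = "\<lambda>T. mat nr nc (\<lambda>p. if p \<in> T then A $$ p else 0)"
  have *: "N (?R T) \<le> (\<Sum>q\<in>T. cmod (A $$ q) * N (?E q))" if "finite T" for T
    using that
  proof induction
    case empty
    have "?R {} = 0\<^sub>m nr nc" by auto
    moreover have "N (0\<^sub>m nr nc) = 0"
by (rule matrix_norm_onD[OF N A A])
    ultimately show ?case by simp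
  next
    case (insert q T)
    have "?R (insert q T) = A $$ q \<cdot>\<^sub>m ?E q + ?R T" using insert.hyps by (intro eq_matI) auto
    moreover have "N (A $$ q \<cdot>\<^sub>m ?E q + ?R T) \<le> N (A $$ q \<cdot>\<^sub>m ?E q) + N (?R T)"
      by (intro matrix_norm_onD[OF N]) auto
    moreover have "N (A $$ q \<cdot>\<^sub>m ?E q) = cmod (A $$ q) * N (?E q)"
      by (intro matrix_norm_onD[OF N]) auto
    ultimately show ?case using insert by simp
  qed
  have "?R ({..<nr} \<times> {..<nc}) = A" using A by (intro eq_matI) auto
  then show ?thesis using *[of "{..<nr} \<times> {..<nc}"] by (simp add: case_prod_unfold)
qed

lemma matrix_norm_on_abs_diff_le:
  assumes N: "matrix_norm_on nr nc N"
    and A: "A \<in> carrier_mat nr nc" and B: "B \<in> carrier_mat nr nc"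
  shows "\<bar>N A - N B\<bar> \<le> N (A - B)"
proof -
  have "N A \<le> N (A - B) + N B"
  proof -
    have "A = (A - B) + B" using A B by (intro eq_matI) auto
    then show ?thesis using N A B unfolding matrix_norm_on_def by (metis minus_carrier_mat)
  qed
  moreover have "N B \<le> N (A - B) + N A"
  proof -
    \<comment> \<open>The symmetry of the norm under negation comes from homogeneity with the scalar
      -1.\<close>
    have "B = (-1) \<cdot>\<^sub>m (A - B) + A" using A B by (intro eq_matI) auto
    then have "N B \<le> N ((-1) \<cdot>\<^sub>m (A - B)) + N A"
      using N A B unfolding matrix_norm_on_def by (metis minus_carrier_mat smult_carrier_mat)
    also have "N ((-1) \<cdot>\<^sub>m (A - B)) = cmod (-1) * N (A - B)"
      using N minus_carrier_mat[OF B] unfolding matrix_norm_on_def by blast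
    finally show ?thesis by simp
  qed
  ultimately show ?thesis by simp
qed

lemma matrix_norm_on_bigo:
  assumes N: "matrix_norm_on nr nc N"
    and F: "\<forall>\<^sub>F s in G. F s \<in> carrier_mat nr nc"
    and bigo: "\<And>i j. i < nr \<Longrightarrow> j < nc \<Longrightarrow> (\<lambda>s. F s $$ (i, j)) \<in> O[G](\<lambda>s. complex_of_real (g s))"
  shows "(\<lambda>s. N (F s)) \<in> O[G](g)"
proof -
  let ?b = "\<lambda>s. \<Sum>(i, j)\<in>{..<nr} \<times> {..<nc}.
      cmod (F s $$ (i, j)) * N (mat nr nc (\<lambda>p. if p = (i, j) then 1 else 0))"
  have "(\<lambda>s. N (F s)) \<in> O[G](?b)"
  proof (rule landau_o.big_mono)
    show "\<forall>\<^sub>F s in G. norm (N (F s)) \<le> norm (?b s)"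
      using F
    proof eventually_elim
      case (elim s)
      have "0 \<le> N (F s)" using N elim by (simp add: matrix_norm_on_def)
      then show ?case using matrix_norm_on_le_sum[OF N elim] by simp
    qed
  qed
  also have "?b \<in> O[G](g)"
  proof (rule big_sum_in_bigo, unfold case_prod_unfold)
    fix q assume q: "q \<in> {..<nr} \<times> {..<nc}"
    have "(\<lambda>s. cmod (F s $$ q)) \<in> O[G](g)"
      using bigo[of "fst q" "snd q"] q by (auto simp: bigo_def)
    then show "(\<lambda>s. cmod (F s $$ (fst q, snd q)) *
        N (mat nr nc (\<lambda>p. if p = (fst q, snd q) then 1 else 0))) \<in> O[G](g)"
      \<comment> \<open>A nonzero constant factor does not affect a Landau class; a zero factor
        makes the function vanish.\<close>
      by (cases "N (mat nr nc (\<lambda>p. if p = q then 1 else 0)) = 0") simp_all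
  qed
  finally show ?thesis .
qed

section \<open>Second order models and their projections\<close>

definition so_model_dims :: "nat \<Rightarrow> nat \<Rightarrow> nat \<Rightarrow> so_model \<Rightarrow> bool" where
  "so_model_dims n p\<^sub>i p\<^sub>o S \<longleftrightarrow>
     mass_mat S \<in> carrier_mat n n \<and> damping_mat S \<in> carrier_mat n n \<and>
     stiffness_mat S \<in> carrier_mat n n \<and> input_mat S \<in> carrier_mat n p\<^sub>i \<and>
     output_mat S \<in> carrier_mat p\<^sub>o n"

lemma so_model_dimsD:
  assumes "so_model_dims n p\<^sub>i p\<^sub>o S"
  shows "mass_mat S \<in> carrier_mat n n" "damping_mat S \<in> carrier_mat n n"
    "stiffness_mat S \<in> carrier_mat n n" "input_mat S \<in> carrier_mat n p\<^sub>i"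
    "output_mat S \<in> carrier_mat p\<^sub>o n"
    "shifted_damping s\<^sub>0 S \<in> carrier_mat n n" "shifted_stiffness s\<^sub>0 S \<in> carrier_mat n n"
    "dynamic_mat s\<^sub>0 S s \<in> carrier_mat n n"
  using assms
  by (auto simp: so_model_dims_def shifted_damping_def shifted_stiffness_def dynamic_mat_def)

lemma so_model_dims_reduced_model:
  assumes "so_model_dims n p\<^sub>i p\<^sub>o S" "V \<in> carrier_mat n q" "W \<in> carrier_mat n q"
  shows "so_model_dims q p\<^sub>i p\<^sub>o (reduced_model V W S)"
  using assms by (auto simp: so_model_dims_def reduced_model_def)

text \<open>Two-sided multiplication is linear in the middle factor. It is applied with the
  transpose of \<open>W\<close> on the left and \<open>V\<close> on the right, to commute projection
  with the shift of the coefficients.\<close>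

lemma mult_smult_add_mult_mat:
  fixes L :: "'a :: comm_ring_1 mat"
  assumes "L \<in> carrier_mat k n" "X \<in> carrier_mat n n" "Y \<in> carrier_mat n n" "Q \<in> carrier_mat n l"
  shows "L * (a \<cdot>\<^sub>m X + Y) * Q = a \<cdot>\<^sub>m (L * X * Q) + L * Y * Q"
proof -
  have LX: "L * X \<in> carrier_mat k n" and LY: "L * Y \<in> carrier_mat k n" using assms by auto
  have "L * (a \<cdot>\<^sub>m X + Y) = L * (a \<cdot>\<^sub>m X) + L * Y"
    using assms by (intro mult_add_distrib_mat) auto
  also have "L * (a \<cdot>\<^sub>m X) = a \<cdot>\<^sub>m (L * X)" using assms by (intro mult_smult_distrib) auto
  finally have "L * (a \<cdot>\<^sub>m X + Y) * Q = (a \<cdot>\<^sub>m (L * X) + L * Y) * Q" by (rule arg_cong)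
  also have "\<dots> = (a \<cdot>\<^sub>m (L * X)) * Q + L * Y * Q"
    using LX LY assms by (intro add_mult_distrib_mat) auto
  also have "(a \<cdot>\<^sub>m (L * X)) * Q = a \<cdot>\<^sub>m (L * X * Q)"
    using LX assms by (intro mult_smult_assoc_mat)
  finally show ?thesis .
qed

lemma mult_lincomb3_mult_mat:
  fixes L :: "'a :: comm_ring_1 mat"
  assumes "L \<in> carrier_mat k n" "X \<in> carrier_mat n n" "Y \<in> carrier_mat n n" "Z \<in> carrier_mat n n"
    and "Q \<in> carrier_mat n l"
  shows "L * (a \<cdot>\<^sub>m X + b \<cdot>\<^sub>m Y + Z) * Q = a \<cdot>\<^sub>m (L * X * Q) + b \<cdot>\<^sub>m (L * Y * Q) + L * Z * Q"
proof -
  have "a \<cdot>\<^sub>m X + b \<cdot>\<^sub>m Y + Z = a \<cdot>\<^sub>m X + (b \<cdot>\<^sub>m Y + Z)" using assms by (intro assoc_add_mat) auto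
  then have "L * (a \<cdot>\<^sub>m X + b \<cdot>\<^sub>m Y + Z) * Q = a \<cdot>\<^sub>m (L * X * Q) + L * (b \<cdot>\<^sub>m Y + Z) * Q"
    using assms by (simp add: mult_smult_add_mult_mat)
  also have "L * (b \<cdot>\<^sub>m Y + Z) * Q = b \<cdot>\<^sub>m (L * Y * Q) + L * Z * Q"
    using assms by (intro mult_smult_add_mult_mat)
  also have "a \<cdot>\<^sub>m (L * X * Q) + (b \<cdot>\<^sub>m (L * Y * Q) + L * Z * Q) =
      a \<cdot>\<^sub>m (L * X * Q) + b \<cdot>\<^sub>m (L * Y * Q) + L * Z * Q"
    using assms by (intro assoc_add_mat[symmetric]) (auto intro!: mult_carrier_mat)
  finally show ?thesis .
qed

text \<open>The shifted coefficients and the dynamic matrix are linear combinations of mass, damping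
  and stiffness matrix, and projection is linear; hence projecting before or after evaluating at
  \<open>s\<close> gives the same matrix.\<close>

lemma dynamic_mat_reduced_model:
  assumes S: "so_model_dims n p\<^sub>i p\<^sub>o S" and V: "V \<in> carrier_mat n q" and W: "W \<in> carrier_mat n q"
  shows "dynamic_mat s\<^sub>0 (reduced_model V W S) s = transpose_mat W * dynamic_mat s\<^sub>0 S s * V"
proof -
  have W': "transpose_mat W \<in> carrier_mat q n" using W by simp
  note dims = so_model_dimsD(1-3)[OF S] so_model_dimsD(6,7)[OF S, of s\<^sub>0]
  have "shifted_stiffness s\<^sub>0 (reduced_model V W S) = transpose_mat W * shifted_stiffness s\<^sub>0 S * V"
    unfolding shifted_stiffness_def reduced_model_def so_model.simps
    by (rule mult_lincomb3_mult_mat[OF W' dims(1-3) V, symmetric])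
  moreover have "shifted_damping s\<^sub>0 (reduced_model V W S) = transpose_mat W * shifted_damping s\<^sub>0 S * V"
    unfolding shifted_damping_def reduced_model_def so_model.simps
    by (rule mult_smult_add_mult_mat[OF W' dims(1,2) V, symmetric])
  moreover have "mass_mat (reduced_model V W S) = transpose_mat W * mass_mat S * V"
    by (simp add: reduced_model_def)
  ultimately show ?thesis
    unfolding dynamic_mat_def
    by (simp only: mult_lincomb3_mult_mat[OF W' dims(1,4,5) V])
qed

lemma mat_cont_at_dynamic_mat:
  assumes S: "so_model_dims n p\<^sub>i p\<^sub>o S"
  shows "mat_cont_at a n n (\<lambda>s. dynamic_mat s\<^sub>0 S s)"
  unfolding dynamic_mat_def
  by (intro mat_cont_at_add mat_cont_at_smult mat_cont_at_const so_model_dimsD(1)[OF S]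
      so_model_dimsD(6,7)[OF S, of s\<^sub>0] continuous_intros)

lemma dynamic_mat_expansion_point:
  assumes "so_model_dims n p\<^sub>i p\<^sub>o S"
  shows "dynamic_mat s\<^sub>0 S s\<^sub>0 = shifted_stiffness s\<^sub>0 S"
  unfolding dynamic_mat_def
  using so_model_dimsD(1)[OF assms] so_model_dimsD(6,7)[OF assms, of s\<^sub>0]
  by (intro eq_matI) auto

lemma dynamic_mat_mult:
  assumes S: "so_model_dims n p\<^sub>i p\<^sub>o S" and X: "X \<in> carrier_mat n p"
  shows "dynamic_mat s\<^sub>0 S s * X = (s - s\<^sub>0)\<^sup>2 \<cdot>\<^sub>m (mass_mat S * X)
    + (s - s\<^sub>0) \<cdot>\<^sub>m (shifted_damping s\<^sub>0 S * X) + shifted_stiffness s\<^sub>0 S * X"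
proof -
  note dims = so_model_dimsD(1)[OF S] so_model_dimsD(6,7)[OF S, of s\<^sub>0]
  show ?thesis
    \<comment> \<open>The two-sided expansion with the identity as left factor.\<close>
    using mult_lincomb3_mult_mat[OF one_carrier_mat dims X, of "(s - s\<^sub>0)\<^sup>2" "s - s\<^sub>0"]
      dims so_model_dimsD(8)[OF S, of s\<^sub>0 s]
    by (simp add: dynamic_mat_def)
qed

section \<open>Moment matching\<close>

text \<open>The coefficient of \<open>(s - s\<^sub>0) ^ k\<close> in \<open>dynamic_mat s\<^sub>0 S s * (\<Sum>j\<le>m. (s - s\<^sub>0) ^ j \<cdot>\<^sub>m P j)\<close>
  vanishes for \<open>1 \<le> k \<le> m\<close>, which leaves a residual of order \<open>m + 1\<close>.\<close>

lemma moment_sum_residual: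
  assumes S: "so_model_dims n p\<^sub>i p\<^sub>o S" and V: "V \<in> carrier_mat n q"
    and P: "\<And>j. P j \<in> carrier_mat n p\<^sub>i"
    and P0: "shifted_stiffness s\<^sub>0 S * P 0 = - input_mat S"
    and P1: "shifted_stiffness s\<^sub>0 S * P 1 = - (shifted_damping s\<^sub>0 S * P 0)"
    and P2: "\<And>j. shifted_stiffness s\<^sub>0 S * P (Suc (Suc j)) =
               - (shifted_damping s\<^sub>0 S * P (Suc j)) - mass_mat S * P j"
    and PV: "\<And>j. j \<le> m \<Longrightarrow> \<exists>Y \<in> carrier_mat q p\<^sub>i. P j = V * Y"
  shows "\<exists>Y \<in> carrier_mat q p\<^sub>i. dynamic_mat s\<^sub>0 S s * (V * Y) =
           (s - s\<^sub>0) ^ Suc m \<cdot>\<^sub>m ((s - s\<^sub>0) \<cdot>\<^sub>m (mass_mat S * P m) - shifted_stiffness s\<^sub>0 S * P (Suc m))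
           - input_mat S"
proof -
  note c = so_model_dimsD(1-5)[OF S] so_model_dimsD(6,7)[OF S, of s\<^sub>0] so_model_dimsD(8)[OF S, of s\<^sub>0 s]
  show ?thesis
    using PV
  proof (induction m)
    case 0
    then obtain Y where Y: "Y \<in> carrier_mat q p\<^sub>i" "P 0 = V * Y" by auto
    \<comment> \<open>Stating the identity for arbitrary matrices in place of the products reduces
      it to ring arithmetic in each entry.\<close>
    have "MP \<in> carrier_mat n p\<^sub>i \<Longrightarrow> DP \<in> carrier_mat n p\<^sub>i \<Longrightarrow> B \<in> carrier_mat n p\<^sub>i \<Longrightarrow>
        \<sigma>\<^sup>2 \<cdot>\<^sub>m MP + \<sigma> \<cdot>\<^sub>m DP + - B = \<sigma> ^ Suc 0 \<cdot>\<^sub>m (\<sigma> \<cdot>\<^sub>m MP - - DP) - B"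
      for MP DP B :: "complex mat" and \<sigma>
      by (intro eq_matI) (auto simp: algebra_simps power2_eq_square)
    then have "dynamic_mat s\<^sub>0 S s * P 0 =
        (s - s\<^sub>0) ^ Suc 0 \<cdot>\<^sub>m ((s - s\<^sub>0) \<cdot>\<^sub>m (mass_mat S * P 0) - shifted_stiffness s\<^sub>0 S * P (Suc 0))
        - input_mat S"
      unfolding dynamic_mat_mult[OF S P] P0 P1[unfolded One_nat_def]
      using c P by (meson mult_carrier_mat)
    then show ?case using Y by auto
  next
    case (Suc m)
    let ?\<sigma> = "s - s\<^sub>0"
    obtain X where X: "X \<in> carrier_mat q p\<^sub>i" "dynamic_mat s\<^sub>0 S s * (V * X) =
        ?\<sigma> ^ Suc m \<cdot>\<^sub>m (?\<sigma> \<cdot>\<^sub>m (mass_mat S * P m) - shifted_stiffness s\<^sub>0 S * P (Suc m)) - input_mat S"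
      using Suc by auto
    obtain Y where Y: "Y \<in> carrier_mat q p\<^sub>i" "P (Suc m) = V * Y" using Suc by auto
    \<comment> \<open>Coordinates with respect to \<open>V\<close> of the partial sum extended by
      the term of degree \<open>Suc m\<close>.\<close>
    let ?Y = "X + ?\<sigma> ^ Suc m \<cdot>\<^sub>m Y"
    have VX: "V * X \<in> carrier_mat n p\<^sub>i" using V X(1) by (rule mult_carrier_mat)
    have "V * ?Y = V * X + V * (?\<sigma> ^ Suc m \<cdot>\<^sub>m Y)"
      using V X(1) Y(1) by (intro mult_add_distrib_mat) auto
    also have "V * (?\<sigma> ^ Suc m \<cdot>\<^sub>m Y) = ?\<sigma> ^ Suc m \<cdot>\<^sub>m P (Suc m)"
      unfolding Y(2) using V Y(1) by (rule mult_smult_distrib)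
    finally have "dynamic_mat s\<^sub>0 S s * (V * ?Y) =
        dynamic_mat s\<^sub>0 S s * (V * X) + dynamic_mat s\<^sub>0 S s * (?\<sigma> ^ Suc m \<cdot>\<^sub>m P (Suc m))"
      using VX P[of "Suc m"] c(8) mult_add_distrib_mat[of "dynamic_mat s\<^sub>0 S s" n n "V * X" p\<^sub>i] by simp
    also have "dynamic_mat s\<^sub>0 S s * (?\<sigma> ^ Suc m \<cdot>\<^sub>m P (Suc m)) =
        ?\<sigma> ^ Suc m \<cdot>\<^sub>m (dynamic_mat s\<^sub>0 S s * P (Suc m))"
      using c(8) P by (rule mult_smult_distrib)
    finally have eq: "dynamic_mat s\<^sub>0 S s * (V * ?Y) =
        dynamic_mat s\<^sub>0 S s * (V * X) + ?\<sigma> ^ Suc m \<cdot>\<^sub>m (dynamic_mat s\<^sub>0 S s * P (Suc m))" .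
    \<comment> \<open>The stiffness part \<open>KP\<close> of the new term cancels the
      \<open>- KP\<close> left in the old residual. What remains has one more factor of
      \<open>\<sigma>\<close>, and by the recurrence \<open>- DQ - MP\<close> is the stiffness
      matrix times the next block.\<close>
    have "MP \<in> carrier_mat n p\<^sub>i \<Longrightarrow> KP \<in> carrier_mat n p\<^sub>i \<Longrightarrow> B \<in> carrier_mat n p\<^sub>i \<Longrightarrow>
        MQ \<in> carrier_mat n p\<^sub>i \<Longrightarrow> DQ \<in> carrier_mat n p\<^sub>i \<Longrightarrow>
        \<sigma> ^ Suc m \<cdot>\<^sub>m (\<sigma> \<cdot>\<^sub>m MP - KP) - B + \<sigma> ^ Suc m \<cdot>\<^sub>m (\<sigma>\<^sup>2 \<cdot>\<^sub>m MQ + \<sigma> \<cdot>\<^sub>m DQ + KP) =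
        \<sigma> ^ Suc (Suc m) \<cdot>\<^sub>m (\<sigma> \<cdot>\<^sub>m MQ - (- DQ - MP)) - B"
      for MP KP B MQ DQ :: "complex mat" and \<sigma>
      by (intro eq_matI) (auto simp: algebra_simps power2_eq_square)
    then have "dynamic_mat s\<^sub>0 S s * (V * ?Y) =
        ?\<sigma> ^ Suc (Suc m) \<cdot>\<^sub>m (?\<sigma> \<cdot>\<^sub>m (mass_mat S * P (Suc m)) - shifted_stiffness s\<^sub>0 S * P (Suc (Suc m)))
        - input_mat S"
      unfolding eq dynamic_mat_mult[OF S P] X(2) P2
      using c P by (meson mult_carrier_mat)
    moreover have "?Y \<in> carrier_mat q p\<^sub>i" using X(1) Y(1) by simp
    ultimately show ?case by blast
  qed
qed

text \<open>Every column of \<open>A\<close> is \<open>V\<close> times a coordinate vector; these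
  vectors are the columns of \<open>Y\<close>.\<close>

lemma mat_cols_in_span_factor:
  assumes V: "V \<in> carrier_mat n q" and A: "A \<in> carrier_mat n p"
    and span: "set (cols A) \<subseteq> cspan n (set (cols V))"
  shows "\<exists>Y \<in> carrier_mat q p. A = V * Y"
proof -
  interpret vs: vec_space "TYPE(complex)" n .
  have "\<exists>y \<in> carrier_vec q. V *\<^sub>v y = col A j" if "j < p" for j
  proof -
    have "col A j \<in> vs.col_space V"
      using span that A by (auto simp: vs.col_space_def cols_def)
    then show ?thesis using vs.col_space_eq[OF V] V by auto
  qed
  then obtain y where y: "\<And>j. j < p \<Longrightarrow> y j \<in> carrier_vec q" "\<And>j. j < p \<Longrightarrow> V *\<^sub>v y j = col A j"
    by metis
  let ?Y = "mat q p (\<lambda>(i, j). y j $ i)"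
  have "A = V * ?Y"
  proof (rule mat_col_eqI)
    fix j assume "j < dim_col (V * ?Y)"
    then have j: "j < p" by simp
    have "col ?Y j = y j" using y(1)[OF j] j by (intro eq_vecI) auto
    then show "col A j = col (V * ?Y) j" using y(2)[OF j] V j by (simp add: col_mult2[of _ n q _ p])
  qed (use V A in auto)
  then show ?thesis by (intro bexI[of _ ?Y]) auto
qed

section \<open>Krylov blocks and the spaces they span\<close>

lemma krylov_block_carrier:
  assumes "A\<^sub>1 \<in> carrier_mat n n" "A\<^sub>2 \<in> carrier_mat n n" "P \<in> carrier_mat n p"
  shows "krylov_block A\<^sub>1 A\<^sub>2 P j \<in> carrier_mat n p"
  using assms by (induction A\<^sub>1 A\<^sub>2 P j rule: krylov_block.induct) auto

lemma krylov_block_in_krylov_space: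
  assumes "A\<^sub>1 \<in> carrier_mat n n" "A\<^sub>2 \<in> carrier_mat n n" "P \<in> carrier_mat n p" "j < r"
  shows "set (cols (krylov_block A\<^sub>1 A\<^sub>2 P j)) \<subseteq> krylov_space r A\<^sub>1 A\<^sub>2 P"
proof -
  interpret vs: vec_space "TYPE(complex)" n .
  let ?U = "\<Union>j<r. set (cols (krylov_block A\<^sub>1 A\<^sub>2 P j))"
  have "?U \<subseteq> carrier_vec n"
    using krylov_block_carrier[OF assms(1-3)] cols_dim by (metis UN_least carrier_matD(1))
  then have "?U \<subseteq> vs.span ?U" by (intro vs.in_own_span) auto
  then show ?thesis using assms(3,4) by (auto simp: krylov_space_def)
qed

lemma mult_uminus_inverse_mult:
  fixes A :: "'a :: comm_ring_1 mat"
  assumes "A \<in> carrier_mat n n" "Z \<in> carrier_mat n n" "Q \<in> carrier_mat n k" "A * Z = 1\<^sub>m n"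
  shows "A * (- Z * Q) = - Q"
proof -
  have "A * (- Z * Q) = - (A * (Z * Q))" using assms by simp
  also have "A * (Z * Q) = (A * Z) * Q" using assms by (intro assoc_mult_mat[symmetric])
  finally show ?thesis using assms by simp
qed

lemma mult_smult_minus_distrib_mat:
  fixes L :: "'a :: comm_ring_1 mat"
  assumes "L \<in> carrier_mat k n" "X \<in> carrier_mat n l" "Y \<in> carrier_mat n l"
  shows "L * (a \<cdot>\<^sub>m X - Y) = a \<cdot>\<^sub>m (L * X) - L * Y"
proof -
  have "L * (a \<cdot>\<^sub>m X - Y) = L * (a \<cdot>\<^sub>m X) - L * Y"
    using assms by (intro mult_minus_distrib_mat) auto
  also have "L * (a \<cdot>\<^sub>m X) = a \<cdot>\<^sub>m (L * X)" using assms(1,2) by (rule mult_smult_distrib)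
  finally show ?thesis .
qed

section \<open>Comparison of the full and the reduced transfer function\<close>

lemma transfer_carrier:
  assumes S: "so_model_dims n p\<^sub>i p\<^sub>o S" and "transfer_defined s\<^sub>0 S s"
  shows "transfer s\<^sub>0 S s \<in> carrier_mat p\<^sub>o p\<^sub>i"
  unfolding transfer_def
  using so_model_dimsD(4,5)[OF S] minv(1)[OF assms(2)[unfolded transfer_defined_def] so_model_dimsD(8)[OF S]]
  by (intro mult_carrier_mat)

text \<open>Both transfer functions are, up to the residual, equal to \<open>- output_mat S * (V * Y)\<close>: the full
  one by solving for \<open>V * Y\<close>, the reduced one by projecting the equation and solving for \<open>Y\<close>.\<close>

lemma transfer_diff_reduced_model:
  assumes S: "so_model_dims n p\<^sub>i p\<^sub>o S" and V: "V \<in> carrier_mat n q" and W: "W \<in> carrier_mat n q"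
    and R: "R = reduced_model V W S"
    and defS: "transfer_defined s\<^sub>0 S s" and defR: "transfer_defined s\<^sub>0 R s"
    and Y: "Y \<in> carrier_mat q p\<^sub>i" and E: "E \<in> carrier_mat n p\<^sub>i"
    and eq: "dynamic_mat s\<^sub>0 S s * (V * Y) = c \<cdot>\<^sub>m E - input_mat S"
  shows "transfer s\<^sub>0 S s - transfer s\<^sub>0 R s =
    c \<cdot>\<^sub>m (output_mat S * minv (dynamic_mat s\<^sub>0 S s) * E
        - output_mat S * V * minv (dynamic_mat s\<^sub>0 R s) * (transpose_mat W * E))"
proof -
  define A where "A = dynamic_mat s\<^sub>0 S s"
  define A' where "A' = dynamic_mat s\<^sub>0 R s"
  define B where "B = input_mat S"
  define C where "C = output_mat S"
  define Wt where "Wt = transpose_mat W"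
  have A: "A \<in> carrier_mat n n" and B: "B \<in> carrier_mat n p\<^sub>i" and C: "C \<in> carrier_mat p\<^sub>o n"
    and Wt: "Wt \<in> carrier_mat q n"
    using so_model_dimsD[OF S] W by (auto simp: A_def B_def C_def Wt_def)
  have A': "A' \<in> carrier_mat q q" and A'_eq: "A' = Wt * A * V"
    using so_model_dimsD(8)[OF so_model_dims_reduced_model[OF S V W]]
      dynamic_mat_reduced_model[OF S V W] by (auto simp: A'_def R A_def Wt_def)
  note Z = minv[OF defS[unfolded transfer_defined_def, folded A_def] A]
  note Z' = minv[OF defR[unfolded transfer_defined_def, folded A'_def] A']
  have eq: "A * (V * Y) = c \<cdot>\<^sub>m E - B" using eq by (simp add: A_def B_def)
  have VY: "V * Y \<in> carrier_mat n p\<^sub>i" using V Y by (rule mult_carrier_mat)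
  have CZ: "C * minv A \<in> carrier_mat p\<^sub>o n" using C Z(1) by (rule mult_carrier_mat)
  have CV: "C * V \<in> carrier_mat p\<^sub>o q" using C V by (rule mult_carrier_mat)
  have CVZ: "C * V * minv A' \<in> carrier_mat p\<^sub>o q" using CV Z'(1) by (rule mult_carrier_mat)
  have CVZW: "C * V * minv A' * Wt \<in> carrier_mat p\<^sub>o n" using CVZ Wt by (rule mult_carrier_mat)
  have WA: "Wt * A \<in> carrier_mat q n" using Wt A by (rule mult_carrier_mat)
  \<comment> \<open>First evaluation: the full order equation is solved for
    \<open>V * Y\<close>.\<close>
  have "C * (V * Y) = C * (minv A * A * (V * Y))"
    unfolding Z(3) left_mult_one_mat[OF VY] ..
  also have "\<dots> = C * (minv A * (A * (V * Y)))" using assoc_mult_mat[OF Z(1) A VY] by simp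
  also have "\<dots> = C * minv A * (A * (V * Y))"
    using assoc_mult_mat[OF C Z(1) mult_carrier_mat[OF A VY]] by simp
  also have "\<dots> = c \<cdot>\<^sub>m (C * minv A * E) - C * minv A * B"
    unfolding eq using CZ E B by (rule mult_smult_minus_distrib_mat)
  finally have 1: "C * (V * Y) = c \<cdot>\<^sub>m (C * minv A * E) - C * minv A * B" .
  have "C * (V * Y) = C * V * (minv A' * A' * Y)"
    unfolding Z'(3) left_mult_one_mat[OF Y] using assoc_mult_mat[OF C V Y] by (rule sym)
  also have "\<dots> = C * V * (minv A' * (A' * Y))" unfolding assoc_mult_mat[OF Z'(1) A' Y] ..
  also have "\<dots> = C * V * minv A' * (A' * Y)"
    using assoc_mult_mat[OF CV Z'(1) mult_carrier_mat[OF A' Y]] by simp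
  \<comment> \<open>Since \<open>A'\<close> is the projection of \<open>A\<close>, the reduced
    matrix applied to \<open>Y\<close> is the projected left side of the full order
    equation.\<close>
  also have "A' * Y = Wt * (A * (V * Y))"
    unfolding A'_eq using assoc_mult_mat[OF WA V Y] assoc_mult_mat[OF Wt A VY] by simp
  also have "C * V * minv A' * (Wt * (A * (V * Y))) = C * V * minv A' * Wt * (A * (V * Y))"
    using assoc_mult_mat[OF CVZ Wt mult_carrier_mat[OF A VY]] by simp
  also have "\<dots> = c \<cdot>\<^sub>m (C * V * minv A' * Wt * E) - C * V * minv A' * Wt * B"
    unfolding eq using CVZW E B by (rule mult_smult_minus_distrib_mat)
  also have "C * V * minv A' * Wt * E = C * V * minv A' * (Wt * E)"
    using CVZ Wt E by (rule assoc_mult_mat)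
  also have "C * V * minv A' * Wt * B = C * V * minv A' * (Wt * B)"
    using CVZ Wt B by (rule assoc_mult_mat)
  finally have 2: "C * (V * Y) = c \<cdot>\<^sub>m (C * V * minv A' * (Wt * E)) - C * V * minv A' * (Wt * B)" .
  have "G \<in> carrier_mat p\<^sub>o p\<^sub>i \<Longrightarrow> G' \<in> carrier_mat p\<^sub>o p\<^sub>i \<Longrightarrow> H \<in> carrier_mat p\<^sub>o p\<^sub>i \<Longrightarrow>
      H' \<in> carrier_mat p\<^sub>o p\<^sub>i \<Longrightarrow> c \<cdot>\<^sub>m H - G = c \<cdot>\<^sub>m H' - G' \<Longrightarrow> G - G' = c \<cdot>\<^sub>m (H - H')"
    for G G' H H' :: "complex mat"
    by (auto simp: mat_eq_iff algebra_simps)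
  from this[OF _ _ _ _ trans[OF 1[symmetric] 2]]
  have "C * minv A * B - C * V * minv A' * (Wt * B) =
      c \<cdot>\<^sub>m (C * minv A * E - C * V * minv A' * (Wt * E))"
    using CZ CVZ Wt B E by (meson mult_carrier_mat)
  then show ?thesis
    by (simp add: transfer_def R reduced_model_def A_def A'_def B_def C_def Wt_def)
qed

text \<open>The dynamic matrix at \<open>s\<^sub>0\<close> is the shifted stiffness matrix, and
  invertibility persists near a point of continuity. This makes the full transfer function
  well-defined near \<open>s\<^sub>0\<close>.\<close>

lemma eventually_transfer_defined:
  assumes S: "so_model_dims n p\<^sub>i p\<^sub>o S" and inv: "invertible_mat (shifted_stiffness s\<^sub>0 S)"
  shows "\<forall>\<^sub>F s in nhds s\<^sub>0. transfer_defined s\<^sub>0 S s"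
proof -
  obtain Z where "\<forall>\<^sub>F s in nhds s\<^sub>0. invertible_mat (dynamic_mat s\<^sub>0 S s) \<and> minv (dynamic_mat s\<^sub>0 S s) = Z s"
    using mat_cont_at_minv[OF mat_cont_at_dynamic_mat[OF S, of s\<^sub>0 s\<^sub>0]] inv
    by (auto simp: dynamic_mat_expansion_point[OF S])
  then show ?thesis by eventually_elim (simp add: transfer_defined_def)
qed

text \<open>Multiplying the Krylov recurrence by the shifted stiffness matrix gives the relations
  required by \<open>moment_sum_residual\<close>. The space of index \<open>Suc m\<close> contains
  blocks \<open>0\<close> to \<open>m\<close>; block \<open>Suc m\<close> enters only through
  \<open>E\<close>.\<close>

lemma krylov_residual:
  assumes S: "so_model_dims n p\<^sub>i p\<^sub>o S" and V: "V \<in> carrier_mat n q"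
    and inv: "invertible_mat (shifted_stiffness s\<^sub>0 S)"
    and sub: "input_krylov s\<^sub>0 S (Suc m) \<subseteq> cspan n (set (cols V))"
  obtains E where "mat_cont_at s\<^sub>0 n p\<^sub>i E"
    "\<And>s. \<exists>Y \<in> carrier_mat q p\<^sub>i.
        dynamic_mat s\<^sub>0 S s * (V * Y) = (s - s\<^sub>0) ^ Suc m \<cdot>\<^sub>m E s - input_mat S"
proof -
  define Kt where "Kt = shifted_stiffness s\<^sub>0 S"
  define Dt where "Dt = shifted_damping s\<^sub>0 S"
  define M where "M = mass_mat S"
  define B where "B = input_mat S"
  have c: "Kt \<in> carrier_mat n n" "Dt \<in> carrier_mat n n" "M \<in> carrier_mat n n" "B \<in> carrier_mat n p\<^sub>i"
    using so_model_dimsD[OF S] by (auto simp: Kt_def Dt_def M_def B_def)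
  note Ki = minv[OF inv[folded Kt_def] c(1)]
  let ?A1 = "- minv Kt * Dt" and ?A2 = "- minv Kt * M" and ?P0 = "- minv Kt * B"
  define P where "P = krylov_block ?A1 ?A2 ?P0"
  have A: "?A1 \<in> carrier_mat n n" "?A2 \<in> carrier_mat n n" "?P0 \<in> carrier_mat n p\<^sub>i"
    using Ki(1) c by (auto intro!: mult_carrier_mat)
  have P: "P j \<in> carrier_mat n p\<^sub>i" for j
    unfolding P_def by (rule krylov_block_carrier[OF A])
  have solve: "Kt * (- minv Kt * Q * X) = - (Q * X)"
    if "Q \<in> carrier_mat n n" "X \<in> carrier_mat n p\<^sub>i" for Q X
  proof -
    have "- minv Kt * Q * X = - minv Kt * (Q * X)"
      using Ki(1) that by (intro assoc_mult_mat) auto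
    then show ?thesis
      using mult_uminus_inverse_mult[OF c(1) Ki(1) mult_carrier_mat[OF that] Ki(2)] by simp
  qed
  have P0: "Kt * P 0 = - B"
    unfolding P_def using mult_uminus_inverse_mult[OF c(1) Ki(1) c(4) Ki(2)] by simp
  have P1: "Kt * P 1 = - (Dt * P 0)"
    using solve[OF c(2) P[of 0]] by (simp add: P_def)
  have P2: "Kt * P (Suc (Suc j)) = - (Dt * P (Suc j)) - M * P j" for j
  proof -
    have rec: "P (Suc (Suc j)) = ?A1 * P (Suc j) + ?A2 * P j" by (simp only: P_def krylov_block.simps)
    have "Kt * P (Suc (Suc j)) = Kt * (?A1 * P (Suc j)) + Kt * (?A2 * P j)"
      unfolding rec
      using mult_add_distrib_mat[OF c(1) mult_carrier_mat[OF A(1) P] mult_carrier_mat[OF A(2) P]] .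
    also have "\<dots> = - (Dt * P (Suc j)) + - (M * P j)" by (simp only: solve[OF c(2) P] solve[OF c(3) P])
    also have "\<dots> = - (Dt * P (Suc j)) - M * P j"
      using mult_carrier_mat[OF c(2) P[of "Suc j"]] mult_carrier_mat[OF c(3) P[of j]]
      by (intro add_uminus_minus_mat) auto
    finally show ?thesis .
  qed
  have PV: "\<exists>Y \<in> carrier_mat q p\<^sub>i. P j = V * Y" if "j \<le> m" for j
  proof (rule mat_cols_in_span_factor[OF V P])
    have "set (cols (P j)) \<subseteq> krylov_space (Suc m) ?A1 ?A2 ?P0"
      unfolding P_def using that by (intro krylov_block_in_krylov_space[OF A]) simp
    also have "\<dots> = input_krylov s\<^sub>0 S (Suc m)"
      by (simp add: input_krylov_def Let_def Kt_def Dt_def M_def B_def)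
    finally show "set (cols (P j)) \<subseteq> cspan n (set (cols V))" using sub by blast
  qed
  show thesis
  proof
    show "mat_cont_at s\<^sub>0 n p\<^sub>i (\<lambda>s. (s - s\<^sub>0) \<cdot>\<^sub>m (M * P m) - Kt * P (Suc m))"
      using mult_carrier_mat[OF c(3) P] mult_carrier_mat[OF c(1) P]
      by (intro mat_cont_at_diff mat_cont_at_smult mat_cont_at_const continuous_intros)
    show "\<exists>Y \<in> carrier_mat q p\<^sub>i. dynamic_mat s\<^sub>0 S s * (V * Y) =
        (s - s\<^sub>0) ^ Suc m \<cdot>\<^sub>m ((s - s\<^sub>0) \<cdot>\<^sub>m (M * P m) - Kt * P (Suc m)) - input_mat S" for s
      using moment_sum_residual[of n p\<^sub>i p\<^sub>o S V q P s\<^sub>0 m s] S V P P0 P1 P2 PV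
      unfolding Kt_def Dt_def M_def B_def by blast
  qed
qed

text \<open>The difference is \<open>(s - s\<^sub>0) ^ Suc m\<close> times a matrix function
  continuous at \<open>s\<^sub>0\<close>, hence bounded nearby. Only the shape of \<open>W\<close>
  is prescribed, so the one-sided input method and the two-sided method are both covered.\<close>

lemma transfer_diff_bigo_input_krylov:
  assumes S: "so_model_dims n p\<^sub>i p\<^sub>o S" and V: "V \<in> carrier_mat n q" and W: "W \<in> carrier_mat n q"
    and inv: "invertible_mat (shifted_stiffness s\<^sub>0 S)"
    and sub: "input_krylov s\<^sub>0 S (Suc m) \<subseteq> cspan n (set (cols V))"
    and R: "R = reduced_model V W S"
    and defR: "\<forall>\<^sub>F s in nhds s\<^sub>0. transfer_defined s\<^sub>0 R s"
    and ij: "i < p\<^sub>o" "j < p\<^sub>i"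
  shows "(\<lambda>s. (transfer s\<^sub>0 S s - transfer s\<^sub>0 R s) $$ (i, j))
           \<in> O[nhds s\<^sub>0](\<lambda>s. complex_of_real (cmod (s - s\<^sub>0) ^ Suc m))"
proof -
  obtain E where E: "mat_cont_at s\<^sub>0 n p\<^sub>i E" "\<And>s. \<exists>Y \<in> carrier_mat q p\<^sub>i.
      dynamic_mat s\<^sub>0 S s * (V * Y) = (s - s\<^sub>0) ^ Suc m \<cdot>\<^sub>m E s - input_mat S"
    using krylov_residual[OF S V inv sub] by blast
  have R_dims: "so_model_dims q p\<^sub>i p\<^sub>o R"
    unfolding R by (rule so_model_dims_reduced_model[OF S V W])
  have "invertible_mat (dynamic_mat s\<^sub>0 S s\<^sub>0)"
    using inv by (simp add: dynamic_mat_expansion_point[OF S])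
  then obtain Z where Z: "mat_cont_at s\<^sub>0 n n Z"
    "\<forall>\<^sub>F s in nhds s\<^sub>0. invertible_mat (dynamic_mat s\<^sub>0 S s) \<and> minv (dynamic_mat s\<^sub>0 S s) = Z s"
    by (rule mat_cont_at_minv[OF mat_cont_at_dynamic_mat[OF S]])
  \<comment> \<open>The filter \<open>nhds\<close> includes its centre, so \<open>defR\<close> can
    be read at \<open>s\<^sub>0\<close> itself.\<close>
  have "invertible_mat (dynamic_mat s\<^sub>0 R s\<^sub>0)"
    using eventually_nhds_x_imp_x[OF defR] by (simp add: transfer_defined_def)
  then obtain Z' where Z': "mat_cont_at s\<^sub>0 q q Z'"
    "\<forall>\<^sub>F s in nhds s\<^sub>0. invertible_mat (dynamic_mat s\<^sub>0 R s) \<and> minv (dynamic_mat s\<^sub>0 R s) = Z' s"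
    by (rule mat_cont_at_minv[OF mat_cont_at_dynamic_mat[OF R_dims]])
  \<comment> \<open>The cofactor of the power in \<open>transfer_diff_reduced_model\<close>, with
    both inverses replaced by their everywhere defined versions.\<close>
  define H where "H = (\<lambda>s. output_mat S * Z s * E s - output_mat S * V * Z' s * (transpose_mat W * E s))"
  have H: "mat_cont_at s\<^sub>0 p\<^sub>o p\<^sub>i H"
    unfolding H_def
  proof (intro mat_cont_at_diff mat_cont_at_mult)
    show "mat_cont_at s\<^sub>0 p\<^sub>o n (\<lambda>_. output_mat S)" "mat_cont_at s\<^sub>0 p\<^sub>o n (\<lambda>_. output_mat S)"
      "mat_cont_at s\<^sub>0 n q (\<lambda>_. V)" "mat_cont_at s\<^sub>0 q n (\<lambda>_. transpose_mat W)"
      using so_model_dimsD(5)[OF S] V W by (auto intro: mat_cont_at_const)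
  qed (fact E(1) Z(1) Z'(1))+
  have "\<forall>\<^sub>F s in nhds s\<^sub>0. transfer s\<^sub>0 S s - transfer s\<^sub>0 R s = (s - s\<^sub>0) ^ Suc m \<cdot>\<^sub>m H s"
    using Z(2) Z'(2)
  proof eventually_elim
    case (elim s)
    then have "transfer_defined s\<^sub>0 S s" "transfer_defined s\<^sub>0 R s"
      by (auto simp: transfer_defined_def)
    moreover obtain Y where "Y \<in> carrier_mat q p\<^sub>i"
      "dynamic_mat s\<^sub>0 S s * (V * Y) = (s - s\<^sub>0) ^ Suc m \<cdot>\<^sub>m E s - input_mat S"
      using E(2)[of s] by blast
    ultimately show ?case
      using transfer_diff_reduced_model[OF S V W R _ _ _ mat_cont_at_carrier[OF E(1)]] elim
      by (simp add: H_def)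
  qed
  then have "\<forall>\<^sub>F s in nhds s\<^sub>0. (transfer s\<^sub>0 S s - transfer s\<^sub>0 R s) $$ (i, j) =
      (s - s\<^sub>0) ^ Suc m * H s $$ (i, j)"
    by eventually_elim (use mat_cont_at_carrier[OF H, THEN carrier_matD(1)]
        mat_cont_at_carrier[OF H, THEN carrier_matD(2)] ij in simp)
  moreover have "(\<lambda>s. (s - s\<^sub>0) ^ Suc m * H s $$ (i, j))
      \<in> O[nhds s\<^sub>0](\<lambda>s. complex_of_real (cmod (s - s\<^sub>0) ^ Suc m) * 1)"
  proof (rule landau_o.big.mult)
    show "(\<lambda>s. (s - s\<^sub>0) ^ Suc m) \<in> O[nhds s\<^sub>0](\<lambda>s. complex_of_real (cmod (s - s\<^sub>0) ^ Suc m))"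
      by (intro bigoI[of _ 1]) (simp add: norm_power norm_mult)
    have "((\<lambda>s. H s $$ (i, j)) \<longlongrightarrow> H s\<^sub>0 $$ (i, j)) (nhds s\<^sub>0)"
      using H ij tendsto_at_iff_tendsto_nhds[of "\<lambda>s. H s $$ (i, j)" s\<^sub>0]
      by (simp add: isCont_def mat_cont_at_def)
    then show "(\<lambda>s. H s $$ (i, j)) \<in> O[nhds s\<^sub>0](\<lambda>_. 1)"
      by (intro bigoI_tendsto) auto
  qed
  ultimately show ?thesis by (simp add: landau_o.big.in_cong)
qed

section \<open>Transposed models\<close>

text \<open>The dual system: inputs and outputs are exchanged, so statements about input Krylov
  spaces become statements about output Krylov spaces.\<close>

definition transpose_model :: "so_model \<Rightarrow> so_model" where
  "transpose_model S =
     \<lparr>mass_mat = transpose_mat (mass_mat S), damping_mat = transpose_mat (damping_mat S),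
      stiffness_mat = transpose_mat (stiffness_mat S), input_mat = transpose_mat (output_mat S),
      output_mat = transpose_mat (input_mat S)\<rparr>"

lemma so_model_dims_transpose_model:
  "so_model_dims n p\<^sub>i p\<^sub>o S \<Longrightarrow> so_model_dims n p\<^sub>o p\<^sub>i (transpose_model S)"
  by (simp add: so_model_dims_def transpose_model_def)

lemma shifted_stiffness_transpose_model:
  assumes S: "so_model_dims n p\<^sub>i p\<^sub>o S"
  shows "shifted_stiffness s\<^sub>0 (transpose_model S) = transpose_mat (shifted_stiffness s\<^sub>0 S)"
  using so_model_dimsD(1-3)[OF S] unfolding shifted_stiffness_def transpose_model_def
  by (intro eq_matI) auto

lemma shifted_damping_transpose_model:
  assumes S: "so_model_dims n p\<^sub>i p\<^sub>o S"
  shows "shifted_damping s\<^sub>0 (transpose_model S) = transpose_mat (shifted_damping s\<^sub>0 S)"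
  using so_model_dimsD(1-3)[OF S] unfolding shifted_damping_def transpose_model_def
  by (intro eq_matI) auto

lemma dynamic_mat_transpose_model:
  assumes S: "so_model_dims n p\<^sub>i p\<^sub>o S"
  shows "dynamic_mat s\<^sub>0 (transpose_model S) s = transpose_mat (dynamic_mat s\<^sub>0 S s)"
  using so_model_dimsD(1)[OF S] so_model_dimsD(6,7)[OF S, of s\<^sub>0]
  unfolding dynamic_mat_def shifted_stiffness_transpose_model[OF S] shifted_damping_transpose_model[OF S]
  by (intro eq_matI) (auto simp: transpose_model_def)

lemma minv_transpose:
  assumes "invertible_mat A" "A \<in> carrier_mat n n"
  shows "invertible_mat (transpose_mat A)" "minv (transpose_mat A) = transpose_mat (minv A)"
proof -
  note Z = minv[OF assms]
  have "transpose_mat A * transpose_mat (minv A) = 1\<^sub>m n" "transpose_mat (minv A) * transpose_mat A = 1\<^sub>m n"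
    unfolding transpose_mult[OF Z(1) assms(2), symmetric] transpose_mult[OF assms(2) Z(1), symmetric]
      Z(2,3) by simp_all
  then show "invertible_mat (transpose_mat A)" "minv (transpose_mat A) = transpose_mat (minv A)"
    using minv_eqI[of "transpose_mat A" n "transpose_mat (minv A)"] assms(2) Z(1) by auto
qed

lemma transfer_transpose_model:
  assumes S: "so_model_dims n p\<^sub>i p\<^sub>o S" and "transfer_defined s\<^sub>0 S s"
  shows "transfer_defined s\<^sub>0 (transpose_model S) s"
    "transfer s\<^sub>0 (transpose_model S) s = transpose_mat (transfer s\<^sub>0 S s)"
proof -
  note c = so_model_dimsD(4,5)[OF S] so_model_dimsD(8)[OF S, of s\<^sub>0 s]
  note inv = assms(2)[unfolded transfer_defined_def]
  note Z = minv(1)[OF inv c(3)]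
  show "transfer_defined s\<^sub>0 (transpose_model S) s"
    using minv_transpose(1)[OF inv c(3)] by (simp add: transfer_defined_def dynamic_mat_transpose_model[OF S])
  have "transpose_mat (transfer s\<^sub>0 S s) =
      transpose_mat (input_mat S) * (transpose_mat (minv (dynamic_mat s\<^sub>0 S s)) * transpose_mat (output_mat S))"
    unfolding transfer_def
    using transpose_mult[OF mult_carrier_mat[OF c(2) Z] c(1)] transpose_mult[OF c(2) Z] by simp
  also have "\<dots> = transpose_mat (input_mat S) * transpose_mat (minv (dynamic_mat s\<^sub>0 S s)) * transpose_mat (output_mat S)"
    using c Z by (intro assoc_mult_mat[symmetric]) auto
  finally show "transfer s\<^sub>0 (transpose_model S) s = transpose_mat (transfer s\<^sub>0 S s)"
    by (simp add: transfer_def dynamic_mat_transpose_model[OF S] minv_transpose(2)[OF inv c(3)])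
      (simp add: transpose_model_def)
qed

text \<open>One side uses the inverse of the transposed stiffness matrix, the other the transposed
  inverse; invertibility makes them equal.\<close>

lemma input_krylov_transpose_model:
  assumes S: "so_model_dims n p\<^sub>i p\<^sub>o S" and inv: "invertible_mat (shifted_stiffness s\<^sub>0 S)"
  shows "input_krylov s\<^sub>0 (transpose_model S) r = output_krylov s\<^sub>0 S r"
  unfolding input_krylov_def output_krylov_def shifted_stiffness_transpose_model[OF S]
    shifted_damping_transpose_model[OF S] minv_transpose(2)[OF inv so_model_dimsD(7)[OF S]]
  by (simp add: transpose_model_def)

text \<open>Transposing a product reverses its factors, so \<open>V\<close> and \<open>W\<close>
  exchange roles.\<close>

lemma reduced_model_transpose_model:
  assumes S: "so_model_dims n p\<^sub>i p\<^sub>o S" and V: "V \<in> carrier_mat n q" and W: "W \<in> carrier_mat n q"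
  shows "reduced_model W V (transpose_model S) = transpose_model (reduced_model V W S)"
proof -
  have W': "transpose_mat W \<in> carrier_mat q n" and V': "transpose_mat V \<in> carrier_mat q n"
    using V W by auto
  have "transpose_mat V * transpose_mat A * W = transpose_mat (transpose_mat W * A * V)"
    if A: "A \<in> carrier_mat n n" for A :: "complex mat"
  proof -
    have A': "transpose_mat A \<in> carrier_mat n n" using A by simp
    have "transpose_mat (transpose_mat W * A * V) = transpose_mat V * (transpose_mat A * W)"
      using transpose_mult[OF mult_carrier_mat[OF W' A] V] transpose_mult[OF W' A] by simp
    also have "\<dots> = transpose_mat V * transpose_mat A * W"
      using assoc_mult_mat[OF V' A' W] by simp
    finally show ?thesis by simp
  qed
  then show ?thesis
    using so_model_dimsD(1-3)[OF S] transpose_mult[OF W' so_model_dimsD(4)[OF S]]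
      transpose_mult[OF so_model_dimsD(5)[OF S] V]
    by (simp add: reduced_model_def transpose_model_def)
qed

text \<open>The input result applied to the dual system, with \<open>V\<close> and \<open>W\<close>
  as well as the entry indices \<open>i\<close> and \<open>j\<close> exchanged.\<close>

lemma transfer_diff_bigo_output_krylov:
  assumes S: "so_model_dims n p\<^sub>i p\<^sub>o S" and V: "V \<in> carrier_mat n q" and W: "W \<in> carrier_mat n q"
    and inv: "invertible_mat (shifted_stiffness s\<^sub>0 S)"
    and sub: "output_krylov s\<^sub>0 S (Suc m) \<subseteq> cspan n (set (cols W))"
    and R: "R = reduced_model V W S"
    and defR: "\<forall>\<^sub>F s in nhds s\<^sub>0. transfer_defined s\<^sub>0 R s"
    and ij: "i < p\<^sub>o" "j < p\<^sub>i"
  shows "(\<lambda>s. (transfer s\<^sub>0 S s - transfer s\<^sub>0 R s) $$ (i, j))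
           \<in> O[nhds s\<^sub>0](\<lambda>s. complex_of_real (cmod (s - s\<^sub>0) ^ Suc m))"
proof -
  let ?S = "transpose_model S" and ?R = "transpose_model R"
  have R_dims: "so_model_dims q p\<^sub>i p\<^sub>o R"
    unfolding R by (rule so_model_dims_reduced_model[OF S V W])
  have inv': "invertible_mat (shifted_stiffness s\<^sub>0 ?S)"
    unfolding shifted_stiffness_transpose_model[OF S]
    by (rule minv_transpose(1)[OF inv so_model_dimsD(7)[OF S]])
  have sub': "input_krylov s\<^sub>0 ?S (Suc m) \<subseteq> cspan n (set (cols W))"
    using sub by (simp add: input_krylov_transpose_model[OF S inv])
  have R': "?R = reduced_model W V ?S"
    unfolding R reduced_model_transpose_model[OF S V W] ..
  have defR': "\<forall>\<^sub>F s in nhds s\<^sub>0. transfer_defined s\<^sub>0 ?R s"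
    using defR by eventually_elim (rule transfer_transpose_model[OF R_dims])
  have bigo: "(\<lambda>s. (transfer s\<^sub>0 ?S s - transfer s\<^sub>0 ?R s) $$ (j, i))
           \<in> O[nhds s\<^sub>0](\<lambda>s. complex_of_real (cmod (s - s\<^sub>0) ^ Suc m))"
    by (rule transfer_diff_bigo_input_krylov[OF so_model_dims_transpose_model[OF S] W V inv' sub' R' defR' ij(2,1)])
  \<comment> \<open>The transposition identity is available only where both transfer functions are
    defined, hence the passage to a neighbourhood.\<close>
  have "\<forall>\<^sub>F s in nhds s\<^sub>0. (transfer s\<^sub>0 ?S s - transfer s\<^sub>0 ?R s) $$ (j, i) =
      (transfer s\<^sub>0 S s - transfer s\<^sub>0 R s) $$ (i, j)"
    using defR eventually_transfer_defined[OF S inv]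
  proof eventually_elim
    case (elim s)
    then show ?case
      using transfer_carrier[OF S elim(2)] transfer_carrier[OF R_dims elim(1)] ij
      by (simp add: transfer_transpose_model(2)[OF S] transfer_transpose_model(2)[OF R_dims])
  qed
  from landau_o.big.in_cong[OF this] bigo show ?thesis by blast
qed

section \<open>The error estimator\<close>

lemma krylov_projection_carrier:
  assumes "krylov_projection meth s\<^sub>0 S r V W" "mass_mat S \<in> carrier_mat n n"
  obtains q where "V \<in> carrier_mat n q" "W \<in> carrier_mat n q"
  using assms by (cases meth) (auto simp: orthonormal_basis_mat_def intro!: carrier_matI)

lemma transfer_diff_bigo_krylov_projection:
  assumes S: "so_model_dims n p\<^sub>i p\<^sub>o S" and inv: "invertible_mat (shifted_stiffness s\<^sub>0 S)"
    and proj: "krylov_projection meth s\<^sub>0 S (Suc m) V W" and R: "R = reduced_model V W S"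
    and defR: "\<forall>\<^sub>F s in nhds s\<^sub>0. transfer_defined s\<^sub>0 R s"
    and ij: "i < p\<^sub>o" "j < p\<^sub>i"
  shows "(\<lambda>s. (transfer s\<^sub>0 S s - transfer s\<^sub>0 R s) $$ (i, j))
           \<in> O[nhds s\<^sub>0](\<lambda>s. complex_of_real (cmod (s - s\<^sub>0) ^ Suc m))"
proof -
  have n: "dim_row (mass_mat S) = n" using so_model_dimsD(1)[OF S] by simp
  obtain q where VW: "V \<in> carrier_mat n q" "W \<in> carrier_mat n q"
    using krylov_projection_carrier[OF proj so_model_dimsD(1)[OF S]] .
  \<comment> \<open>The one-sided output method falls under the second case because there
    \<open>W = V\<close>; the two-sided method satisfies both.\<close>
  consider "input_krylov s\<^sub>0 S (Suc m) \<subseteq> cspan n (set (cols V))"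
    | "output_krylov s\<^sub>0 S (Suc m) \<subseteq> cspan n (set (cols W))"
    using proj by (cases meth) (auto simp: orthonormal_basis_mat_def n)
  then show ?thesis
    using transfer_diff_bigo_input_krylov[OF S VW inv _ R defR ij]
      transfer_diff_bigo_output_krylov[OF S VW inv _ R defR ij] by cases
qed

text \<open>With the filter \<open>nhds\<close> the bound also holds at
  \<open>s = s\<^sub>0\<close>, where the right-hand side is zero and the two norms therefore
  agree.\<close>

theorem theorem4p1:
  fixes n p\<^sub>i p\<^sub>o r :: nat
    and M D K B C :: "real mat"
    and k\<^sub>0 :: real and s\<^sub>0 :: complex
    and meth :: krylov_method
    and V W V' W' :: "complex mat"
    and S R R' :: so_model
    and N :: "complex mat \<Rightarrow> real"
  assumes "M \<in> carrier_mat n n" and "D \<in> carrier_mat n n" and "K \<in> carrier_mat n n"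
    and "B \<in> carrier_mat n p\<^sub>i" and "C \<in> carrier_mat p\<^sub>o n"
    and "k\<^sub>0 > 0" and "s\<^sub>0 = \<i> * complex_of_real k\<^sub>0"
    and "S = full_model M D K B C"
    and "invertible_mat (shifted_stiffness s\<^sub>0 S)"
    and "r \<ge> 1"
    and "krylov_projection meth s\<^sub>0 S r V W" and "R = reduced_model V W S"
    and "krylov_projection meth s\<^sub>0 S (r + 1) V' W'" and "R' = reduced_model V' W' S"
    and "\<forall>\<^sub>F s in nhds s\<^sub>0. transfer_defined s\<^sub>0 R s"
    and "\<forall>\<^sub>F s in nhds s\<^sub>0. transfer_defined s\<^sub>0 R' s"
    and "matrix_norm_on p\<^sub>o p\<^sub>i N"
  shows "(\<lambda>s. N (transfer s\<^sub>0 S s - transfer s\<^sub>0 R s) - N (transfer s\<^sub>0 R' s - transfer s\<^sub>0 R s))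
           \<in> O[nhds s\<^sub>0](\<lambda>s. cmod (s - s\<^sub>0) ^ (r + 1))"
proof -
  have S: "so_model_dims n p\<^sub>i p\<^sub>o S"
    using assms(1-5) by (simp add: assms(8) so_model_dims_def full_model_def)
  have R_dims: "\<exists>q. so_model_dims q p\<^sub>i p\<^sub>o (reduced_model X Y S)"
    if "krylov_projection meth s\<^sub>0 S k X Y" for k X Y
    using krylov_projection_carrier[OF that so_model_dimsD(1)[OF S]]
      so_model_dims_reduced_model[OF S] by metis
  \<comment> \<open>The reduced orders \<open>q\<close> and \<open>q'\<close> may differ; the
    transfer functions still share the size \<open>p\<^sub>o\<close> by
    \<open>p\<^sub>i\<close>.\<close>
  obtain q where R: "so_model_dims q p\<^sub>i p\<^sub>o R" using R_dims assms(11,12) by blast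
  obtain q' where R': "so_model_dims q' p\<^sub>i p\<^sub>o R'" using R_dims assms(13,14) by blast
  have ev: "\<forall>\<^sub>F s in nhds s\<^sub>0. transfer s\<^sub>0 S s \<in> carrier_mat p\<^sub>o p\<^sub>i \<and>
      transfer s\<^sub>0 R s \<in> carrier_mat p\<^sub>o p\<^sub>i \<and> transfer s\<^sub>0 R' s \<in> carrier_mat p\<^sub>o p\<^sub>i"
    using eventually_transfer_defined[OF S assms(9)] assms(15,16)
    by eventually_elim (intro conjI transfer_carrier[OF S] transfer_carrier[OF R] transfer_carrier[OF R'])
  have "(\<lambda>s. N (transfer s\<^sub>0 S s - transfer s\<^sub>0 R s) - N (transfer s\<^sub>0 R' s - transfer s\<^sub>0 R s))
      \<in> O[nhds s\<^sub>0](\<lambda>s. N (transfer s\<^sub>0 S s - transfer s\<^sub>0 R' s))"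
  proof (rule landau_o.big_mono)
    show "\<forall>\<^sub>F s in nhds s\<^sub>0.
        norm (N (transfer s\<^sub>0 S s - transfer s\<^sub>0 R s) - N (transfer s\<^sub>0 R' s - transfer s\<^sub>0 R s))
        \<le> norm (N (transfer s\<^sub>0 S s - transfer s\<^sub>0 R' s))"
      using ev
    proof eventually_elim
      case (elim s)
      let ?G = "transfer s\<^sub>0 S s" and ?G1 = "transfer s\<^sub>0 R s" and ?G2 = "transfer s\<^sub>0 R' s"
      \<comment> \<open>\<open>?G1\<close> cancels, so the estimate is governed by the error of the
        later model alone.\<close>
      have "?G - ?G2 = (?G - ?G1) - (?G2 - ?G1)" using elim by (intro eq_matI) auto
      moreover have "\<bar>N (?G - ?G1) - N (?G2 - ?G1)\<bar> \<le> N ((?G - ?G1) - (?G2 - ?G1))"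
        using elim by (intro matrix_norm_on_abs_diff_le[OF assms(17)] minus_carrier_mat) auto
      ultimately show ?case by simp
    qed
  qed
  also have "(\<lambda>s. N (transfer s\<^sub>0 S s - transfer s\<^sub>0 R' s)) \<in> O[nhds s\<^sub>0](\<lambda>s. cmod (s - s\<^sub>0) ^ (r + 1))"
  proof (rule matrix_norm_on_bigo[OF assms(17)])
    show "\<forall>\<^sub>F s in nhds s\<^sub>0. transfer s\<^sub>0 S s - transfer s\<^sub>0 R' s \<in> carrier_mat p\<^sub>o p\<^sub>i"
      using ev by eventually_elim (auto intro: minus_carrier_mat)
    show "(\<lambda>s. (transfer s\<^sub>0 S s - transfer s\<^sub>0 R' s) $$ (i, j))
        \<in> O[nhds s\<^sub>0](\<lambda>s. complex_of_real (cmod (s - s\<^sub>0) ^ (r + 1)))"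
      if "i < p\<^sub>o" "j < p\<^sub>i" for i j
      \<comment> \<open>Here \<open>m = r\<close>: the order \<open>r + 1\<close> comes from
        \<open>R'\<close>, whose bases are built with index \<open>r + 1\<close>.\<close>
      using transfer_diff_bigo_krylov_projection[OF S assms(9) _ assms(14,16) that] assms(13) by simp
  qed
  finally show ?thesis .
qed

end
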